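(* For propositional variables $p,q$, the formula $(p\land(p\to_{\mathtt{c}}q))\to_{\mathtt{i}} q$ is not a theorem of the Hilbert system $(\mathbf{C+J})^{-}$.
   Context: Formulas are built from a countably infinite set $\mathsf{Prop}$ of propositional variables by $A ::= p \mid \bot \mid A \lor A \mid A \land A \mid A \to_{\mathtt{i}} A \mid A \to_{\mathtt{c}} A$; $\mathsf{Form}_{\mathbf{C}}$ is the set of formulas not containing $\to_{\mathtt{i}}$. Persistent formulas are given by $E ::= \bot \mid p \mid A \to_{\mathtt{i}} A \mid E \land E \mid E \lor E$ ($p\in\mathsf{Prop}$, $A$ arbitrary formula). The Hilbert system $(\mathbf{C+J})^{-}$ has axioms: (CL) all substitution instances (uniformly replacing propositional variables by arbitrary formulas) of classical tautologies in $\mathsf{Form}_{\mathbf{C}}$ (two-valued, $\bot$ false, $\to_{\mathtt{c}}$ material implication); (CK) $(A \to_{\mathtt{i}} (B \to_{\mathtt{c}} C)) \to_{\mathtt{c}} ((A \to_{\mathtt{i}} B) \to_{\mathtt{c}} (A \to_{\mathtt{i}} C))$; (ID) $A \to_{\mathtt{i}} A$; (CMP) $(A \to_{\mathtt{i}} B) \to_{\mathtt{c}} (A \to_{\mathtt{c}} B)$; (PER) $A \to_{\mathtt{c}} (B \to_{\mathtt{i}} A)$ for persistent $A$; and exactly two rules: (MPI) from $A$ and $A \to_{\mathtt{i}} B$ infer $B$; (RCN) from $A$ infer $B \to_{\mathtt{i}} A$. (In particular, classical modus ponens for $\to_{\mathtt{c}}$ is not a rule.) Theorems are formulas derivable from the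 axioms by the rules. *)

theory Defs
  imports "HOL-Library.Countable" "HOL-Library.Infinite_Typeclass"
begin

datatype 'p form =
    Var 'p
  | Bot (\<open>\<^bold>\<bottom>\<close>)
  | Or "'p form" "'p form" (infixr \<open>\<^bold>\<or>\<close> 60)
  | And "'p form" "'p form" (infixr \<open>\<^bold>\<and>\<close> 65)
  | IImp "'p form" "'p form" (infixr \<open>\<rightarrow>\<^sub>i\<close> 55)
  | CImp "'p form" "'p form" (infixr \<open>\<rightarrow>\<^sub>c\<close> 55)

inductive_set Form_C :: "'p form set" where
  "Var p \<in> Form_C"
| "\<^bold>\<bottom> \<in> Form_C"
| "A \<in> Form_C \<Longrightarrow> B \<in> Form_C \<Longrightarrow> A \<^bold>\<or> B \<in> Form_C"
| "A \<in> Form_C \<Longrightarrow> B \<in> Form_C \<Longrightarrow> A \<^bold>\<and> B \<in> Form_C"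
| "A \<in> Form_C \<Longrightarrow> B \<in> Form_C \<Longrightarrow> A \<rightarrow>\<^sub>c B \<in> Form_C"

(* Two-valued truth is meant for Form_C only; its value on A \<rightarrow>\<^sub>i B is left unspecified. *)
primrec (nonexhaustive) truth :: "('p \<Rightarrow> bool) \<Rightarrow> 'p form \<Rightarrow> bool" where
  "truth v (Var p) \<longleftrightarrow> v p"
| "truth v \<^bold>\<bottom> \<longleftrightarrow> False"
| "truth v (A \<^bold>\<or> B) \<longleftrightarrow> truth v A \<or> truth v B"
| "truth v (A \<^bold>\<and> B) \<longleftrightarrow> truth v A \<and> truth v B"
| "truth v (A \<rightarrow>\<^sub>c B) \<longleftrightarrow> (truth v A \<longrightarrow> truth v B)"

definition classical_tautology :: "'p form \<Rightarrow> bool" where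
  "classical_tautology A \<longleftrightarrow> A \<in> Form_C \<and> (\<forall>v. truth v A)"

primrec subst :: "('p \<Rightarrow> 'p form) \<Rightarrow> 'p form \<Rightarrow> 'p form" where
  "subst s (Var p) = s p"
| "subst s \<^bold>\<bottom> = \<^bold>\<bottom>"
| "subst s (A \<^bold>\<or> B) = subst s A \<^bold>\<or> subst s B"
| "subst s (A \<^bold>\<and> B) = subst s A \<^bold>\<and> subst s B"
| "subst s (A \<rightarrow>\<^sub>i B) = subst s A \<rightarrow>\<^sub>i subst s B"
| "subst s (A \<rightarrow>\<^sub>c B) = subst s A \<rightarrow>\<^sub>c subst s B"

inductive persistent :: "'p form \<Rightarrow> bool" where
  "persistent \<^bold>\<bottom>"
| "persistent (Var p)"
| "persistent (A \<rightarrow>\<^sub>i B)"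
| "persistent E \<Longrightarrow> persistent F \<Longrightarrow> persistent (E \<^bold>\<and> F)"
| "persistent E \<Longrightarrow> persistent F \<Longrightarrow> persistent (E \<^bold>\<or> F)"

(* The Hilbert system (C+J)^-. Modus ponens for \<rightarrow>\<^sub>c is deliberately absent. *)
inductive CJ_minus_theorem :: "'p form \<Rightarrow> bool" where
  CL: "classical_tautology A \<Longrightarrow> CJ_minus_theorem (subst s A)"
| CK: "CJ_minus_theorem ((A \<rightarrow>\<^sub>i (B \<rightarrow>\<^sub>c C)) \<rightarrow>\<^sub>c ((A \<rightarrow>\<^sub>i B) \<rightarrow>\<^sub>c (A \<rightarrow>\<^sub>i C)))"
| ID: "CJ_minus_theorem (A \<rightarrow>\<^sub>i A)"
| CMP: "CJ_minus_theorem ((A \<rightarrow>\<^sub>i B) \<rightarrow>\<^sub>c (A \<rightarrow>\<^sub>c B))"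
| PER: "persistent A \<Longrightarrow> CJ_minus_theorem (A \<rightarrow>\<^sub>c (B \<rightarrow>\<^sub>i A))"
| MPI: "CJ_minus_theorem A \<Longrightarrow> CJ_minus_theorem (A \<rightarrow>\<^sub>i B) \<Longrightarrow> CJ_minus_theorem B"
| RCN: "CJ_minus_theorem A \<Longrightarrow> CJ_minus_theorem (B \<rightarrow>\<^sub>i A)"

end

theory Submission
  imports Defs
begin

text \<open>
  No axiom other than (ID) has \<open>\<rightarrow>\<^sub>i\<close> as its main connective, so a theorem \<open>A \<rightarrow>\<^sub>i B\<close> arises
  either from (ID), and then \<open>A = B\<close>, or from (RCN), and then \<open>B\<close> is a theorem. In both cases
  (MPI) produces nothing new. Hence the purely syntactic property \<open>pre_theorem\<close> is an
  invariant of derivations; it fails for variables, and therefore also for the given formula.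
\<close>

text \<open>Deliberately coarse: only variables and \<open>\<rightarrow>\<^sub>i\<close> are
  constrained. Accepting even \<open>Bot\<close> leaves no case but variables to exclude among
  tautologies.\<close>

primrec pre_theorem :: "'p form \<Rightarrow> bool" where
  "pre_theorem (Var p) \<longleftrightarrow> False"
| "pre_theorem \<^bold>\<bottom> \<longleftrightarrow> True"
| "pre_theorem (A \<^bold>\<or> B) \<longleftrightarrow> True"
| "pre_theorem (A \<^bold>\<and> B) \<longleftrightarrow> True"
| "pre_theorem (A \<rightarrow>\<^sub>i B) \<longleftrightarrow> A = B \<or> pre_theorem B"
| "pre_theorem (A \<rightarrow>\<^sub>c B) \<longleftrightarrow> True"

lemma classical_tautology_not_Var: "\<not> classical_tautology (Var p)"
  by (auto simp: classical_tautology_def)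

text \<open>Substitution changes the main connective only of a variable, which is never a tautology;
  the remaining shapes in \<open>Form_C\<close> are accepted outright.\<close>

lemma pre_theorem_subst_tautology:
  assumes "classical_tautology A"
  shows "pre_theorem (subst s A)"
proof -
  from assms have "A \<in> Form_C"
    by (simp add: classical_tautology_def)
  then show ?thesis
    using assms by cases (simp_all add: classical_tautology_not_Var)
qed

lemma CJ_minus_theorem_imp_pre_theorem: "CJ_minus_theorem A \<Longrightarrow> pre_theorem A"
  by (induction rule: CJ_minus_theorem.induct) (auto simp: pre_theorem_subst_tautology)

theorem theorem14:
  fixes p q :: "'p :: {countable, infinite}"
  shows "\<not> CJ_minus_theorem ((Var p \<^bold>\<and> (Var p \<rightarrow>\<^sub>c Var q)) \<rightarrow>\<^sub>i Var q)"
  \<comment> \<open>Both disjuncts fail: a conjunction is not \<open>Var q\<close>, and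
    \<open>pre_theorem (Var q)\<close> is false.\<close>
  by (auto dest: CJ_minus_theorem_imp_pre_theorem)

end
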